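(* ($\mathsf{ZFC}$) The axiom $\overline{\mathsf{BA}}_{\rm Lip}(2^\omega)$ implies that all of the cardinals in the Cichoń diagram are greater than $\aleph_1$ (equivalently, $\mathrm{add}(\mathcal N)>\aleph_1$). Hence $\overline{\mathsf{BA}}_{\rm Lip}(\omega^\omega)$ implies this as well.
   Context: On $\omega^\omega$ use the metric $d(x,y)=2^{-k}$ where $k$ is least with $x(k)\neq y(k)$ (and $d(x,x)=0$); $2^\omega$ carries the restricted metric. Lipschitz always means with constant $1$: $f$ is Lipschitz if for all $x,y$ in its domain and all $k<\omega$, $x\upharpoonright k=y\upharpoonright k$ implies $f(x)\upharpoonright k=f(y)\upharpoonright k$. A subset of a topological space is $\aleph_1$-dense if its intersection with every non-empty open set has size exactly $\aleph_1$. $\overline{\mathsf{BA}}_{\rm Lip}(\omega^\omega)$: for all $\aleph_1$-dense $A,B\subseteq\omega^\omega$ there is a Lipschitz $f:\omega^\omega\to\omega^\omega$ such that $f\upharpoonright A$ is a bijection from $A$ onto $B$. $\overline{\mathsf{BA}}_{\rm Lip}(2^\omega)$: for all $\aleph_1$-dense $A,B\subseteq 2^\omega$ there are countably many Lipschitz functions $f_n:2^\omega\to2^\omega$, $n<\omega$, such that $B=\bigcup_{n<\omega}f_n``A$. $\mathrm{add}(\mathcal N)$ is the least cardinal $\kappa$ for which there are $\kappa$ many Lebesgue null sets whose union is not null; it is the smallest cardinal in the Cichoń diagram. *)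

theory Defs
  imports "HOL-Analysis.Analysis"
begin

unbundle cardinal_syntax

section \<open>Sequence spaces and Lipschitz maps\<close>

text \<open>
  Baire space is the type \<open>nat \<Rightarrow> nat\<close> and Cantor space is \<open>nat \<Rightarrow> bool\<close>. Their topology is the
  library's product of discrete topologies. The library also has a metric on such function types,
  but it is not the standard first-difference metric, hence \<open>seq_dist\<close>; \<open>open_iff_seq_dist\<close> shows
  that \<open>seq_dist\<close> induces the library topology.
\<close>

definition seq_dist :: "(nat \<Rightarrow> 'a) \<Rightarrow> (nat \<Rightarrow> 'a) \<Rightarrow> real" where
  "seq_dist x y = (if x = y then 0 else (1/2) ^ (LEAST k. x k \<noteq> y k))"

definition agree_below :: "nat \<Rightarrow> (nat \<Rightarrow> 'a) \<Rightarrow> (nat \<Rightarrow> 'a) \<Rightarrow> bool" where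
  "agree_below k x y \<longleftrightarrow> (\<forall>i<k. x i = y i)"

definition Lip :: "((nat \<Rightarrow> 'a) \<Rightarrow> (nat \<Rightarrow> 'b)) \<Rightarrow> bool" where
  "Lip f \<longleftrightarrow> (\<forall>x y k. agree_below k x y \<longrightarrow> agree_below k (f x) (f y))"

lemma seq_dist_le_iff: "seq_dist x y \<le> (1/2) ^ k \<longleftrightarrow> agree_below k x y"
proof (cases "x = y")
  case True
  then show ?thesis by (simp add: seq_dist_def agree_below_def)
next
  case False
  define m where "m = (LEAST k. x k \<noteq> y k)"
  from False have "\<exists>k. x k \<noteq> y k" by auto
  then have m: "x m \<noteq> y m"
    unfolding m_def by (rule LeastI_ex)
  have m': "x i = y i" if "i < m" for i
    using not_less_Least[of i "\<lambda>k. x k \<noteq> y k"] that by (simp add: m_def)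
  have "agree_below k x y \<longleftrightarrow> k \<le> m"
    unfolding agree_below_def using m m' by (auto simp flip: not_less)
  moreover have "(1/2::real) ^ m \<le> (1/2) ^ k \<longleftrightarrow> k \<le> m"
    by (simp add: power_decreasing_iff)
  ultimately show ?thesis using False by (simp add: seq_dist_def m_def)
qed

lemma Lip_iff_seq_dist: "Lip f \<longleftrightarrow> (\<forall>x y. seq_dist (f x) (f y) \<le> seq_dist x y)"
proof
  assume f: "Lip f"
  show "\<forall>x y. seq_dist (f x) (f y) \<le> seq_dist x y"
  proof (intro allI)
    fix x y
    show "seq_dist (f x) (f y) \<le> seq_dist x y"
    proof (cases "x = y")
      case False
      then obtain k where "seq_dist x y = (1/2) ^ k" by (simp add: seq_dist_def)
      then show ?thesis using f unfolding Lip_def by (metis order_refl seq_dist_le_iff)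
    qed (simp add: seq_dist_def)
  qed
next
  assume "\<forall>x y. seq_dist (f x) (f y) \<le> seq_dist x y"
  then show "Lip f" unfolding Lip_def by (metis order_trans seq_dist_le_iff)
qed

lemma open_iff_agree_below:
  fixes U :: "(nat \<Rightarrow> 'a::discrete_topology) set"
  shows "open U \<longleftrightarrow> (\<forall>x\<in>U. \<exists>k. \<forall>y. agree_below k x y \<longrightarrow> y \<in> U)"
proof
  assume U: "open U"
  show "\<forall>x\<in>U. \<exists>k. \<forall>y. agree_below k x y \<longrightarrow> y \<in> U"
  proof
    fix x assume "x \<in> U"
    with U have "openin (product_topology (\<lambda>i. euclidean) UNIV) U" "x \<in> U"
      by (simp_all add: open_fun_def)
    from product_topology_open_contains_basis[OF this]
    obtain X where X: "x \<in> (\<Pi>\<^sub>E i\<in>UNIV. X i)" "finite {i. X i \<noteq> (UNIV::'a set)}"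
      "(\<Pi>\<^sub>E i\<in>UNIV. X i) \<subseteq> U" by auto
    obtain k where k: "\<And>i. X i \<noteq> UNIV \<Longrightarrow> i < k"
      using X(2) unfolding finite_nat_set_iff_bounded by auto
    have "y \<in> U" if y: "agree_below k x y" for y
    proof -
      have "y i \<in> X i" for i
      proof (cases "X i = UNIV")
        case False
        then have "x i = y i" using k y by (simp add: agree_below_def)
        then show ?thesis using X(1) by (metis PiE_mem UNIV_I)
      qed simp
      then show ?thesis using X(3) by auto
    qed
    then show "\<exists>k. \<forall>y. agree_below k x y \<longrightarrow> y \<in> U" by blast
  qed
next
  assume U: "\<forall>x\<in>U. \<exists>k. \<forall>y. agree_below k x y \<longrightarrow> y \<in> U"
  show "open U"
  proof (subst open_subopen, intro ballI)
    fix x assume "x \<in> U"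
    with U obtain k where k: "\<And>y. agree_below k x y \<Longrightarrow> y \<in> U" by blast
    have "open {y. \<forall>i\<in>{..<k}. y i \<in> {x i}}"
      by (intro product_topology_basis') (auto simp: open_discrete)
    moreover have "{y. \<forall>i\<in>{..<k}. y i \<in> {x i}} \<subseteq> U"
      using k by (auto simp: agree_below_def)
    ultimately show "\<exists>T. open T \<and> x \<in> T \<and> T \<subseteq> U"
      by (intro exI[of _ "{y. \<forall>i\<in>{..<k}. y i \<in> {x i}}"]) auto
  qed
qed

lemma open_iff_seq_dist:
  fixes U :: "(nat \<Rightarrow> 'a::discrete_topology) set"
  shows "open U \<longleftrightarrow> (\<forall>x\<in>U. \<exists>e>0. \<forall>y. seq_dist x y < e \<longrightarrow> y \<in> U)"
proof
  assume U: "open U"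
  show "\<forall>x\<in>U. \<exists>e>0. \<forall>y. seq_dist x y < e \<longrightarrow> y \<in> U"
  proof
    fix x assume "x \<in> U"
    then obtain k where "\<And>y. agree_below k x y \<Longrightarrow> y \<in> U"
      using U open_iff_agree_below by blast
    then show "\<exists>e>0. \<forall>y. seq_dist x y < e \<longrightarrow> y \<in> U"
      by (intro exI[of _ "(1/2) ^ k"]) (auto simp flip: seq_dist_le_iff)
  qed
next
  assume U: "\<forall>x\<in>U. \<exists>e>0. \<forall>y. seq_dist x y < e \<longrightarrow> y \<in> U"
  show "open U"
    unfolding open_iff_agree_below
  proof
    fix x assume "x \<in> U"
    then obtain e where e: "e > 0" "\<And>y. seq_dist x y < e \<Longrightarrow> y \<in> U" using U by blast
    obtain k where "(1/2::real) ^ k < e" using e(1) real_arch_pow_inv[of e "1/2"] by auto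
    then have "y \<in> U" if "agree_below k x y" for y
      using that e(2) by (meson order_le_less_trans seq_dist_le_iff)
    then show "\<exists>k. \<forall>y. agree_below k x y \<longrightarrow> y \<in> U" by blast
  qed
qed


section \<open>The Baumgartner-type axioms\<close>

abbreviation aleph1 :: "nat set rel" where
  "aleph1 \<equiv> cardSuc natLeq"

definition aleph1_dense :: "'a::topological_space set \<Rightarrow> bool" where
  "aleph1_dense A \<longleftrightarrow> (\<forall>U. open U \<and> U \<noteq> {} \<longrightarrow> |A \<inter> U| =o aleph1)"

definition BA_Lip_Baire :: bool where
  "BA_Lip_Baire \<longleftrightarrow>
    (\<forall>A B :: (nat \<Rightarrow> nat) set. aleph1_dense A \<and> aleph1_dense B \<longrightarrow>
      (\<exists>f :: (nat \<Rightarrow> nat) \<Rightarrow> (nat \<Rightarrow> nat). Lip f \<and> bij_betw f A B))"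

definition BA_Lip_Cantor :: bool where
  "BA_Lip_Cantor \<longleftrightarrow>
    (\<forall>A B :: (nat \<Rightarrow> bool) set. aleph1_dense A \<and> aleph1_dense B \<longrightarrow>
      (\<exists>f :: nat \<Rightarrow> (nat \<Rightarrow> bool) \<Rightarrow> (nat \<Rightarrow> bool).
        (\<forall>n. Lip (f n)) \<and> B = (\<Union>n. f n ` A)))"


section \<open>Cardinals of the Cichon diagram\<close>

text \<open>
  The least cardinality of a member of \<open>F\<close>, as a cardinal order. It is unspecified when \<open>F\<close> is
  empty; the families used below are shown to be nonempty.
\<close>

definition least_card :: "'a set set \<Rightarrow> 'a rel" where
  "least_card F = (SOME r. r \<in> card_of ` F \<and> (\<forall>X\<in>F. r \<le>o |X| ))"

lemma least_card:
  assumes "F \<noteq> {}"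
  shows "\<exists>X\<in>F. least_card F = |X|" "Card_order (least_card F)" "X \<in> F \<Longrightarrow> least_card F \<le>o |X|"
proof -
  have "\<exists>r. r \<in> card_of ` F \<and> (\<forall>X\<in>F. r \<le>o |X| )"
    using exists_minim_Card_order[of "card_of ` F"] assms by (auto simp: card_of_Card_order)
  then have *: "least_card F \<in> card_of ` F \<and> (\<forall>X\<in>F. least_card F \<le>o |X| )"
    unfolding least_card_def by (rule someI_ex)
  then show "\<exists>X\<in>F. least_card F = |X|" "X \<in> F \<Longrightarrow> least_card F \<le>o |X|" by auto
  then show "Card_order (least_card F)" by (metis card_of_Card_order)
qed

definition add_ideal :: "'a set set \<Rightarrow> 'a set rel" where
  "add_ideal I = least_card {F. F \<subseteq> I \<and> \<Union>F \<notin> I}"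

definition cov_ideal :: "'a set set \<Rightarrow> 'a set rel" where
  "cov_ideal I = least_card {F. F \<subseteq> I \<and> \<Union>F = UNIV}"

definition non_ideal :: "'a set set \<Rightarrow> 'a rel" where
  "non_ideal I = least_card {X. X \<notin> I}"

definition cof_ideal :: "'a set set \<Rightarrow> 'a set rel" where
  "cof_ideal I = least_card {F. F \<subseteq> I \<and> (\<forall>X\<in>I. \<exists>Y\<in>F. X \<subseteq> Y)}"

definition null_ideal :: "real set set" where
  "null_ideal = null_sets lebesgue"

definition nowhere_dense :: "'a::topological_space set \<Rightarrow> bool" where
  "nowhere_dense S \<longleftrightarrow> interior (closure S) = {}"

definition meager_ideal :: "real set set" where
  "meager_ideal = {A. \<exists>S :: nat \<Rightarrow> real set. (\<forall>n. nowhere_dense (S n)) \<and> A \<subseteq> (\<Union>n. S n)}"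

definition le_star :: "(nat \<Rightarrow> nat) \<Rightarrow> (nat \<Rightarrow> nat) \<Rightarrow> bool" where
  "le_star f g \<longleftrightarrow> (\<forall>\<^sub>F n in sequentially. f n \<le> g n)"

definition bounding_number :: "(nat \<Rightarrow> nat) rel" where
  "bounding_number = least_card {F. \<not> (\<exists>g. \<forall>f\<in>F. le_star f g)}"

definition dominating_number :: "(nat \<Rightarrow> nat) rel" where
  "dominating_number = least_card {F. \<forall>g. \<exists>f\<in>F. le_star g f}"

text \<open>A conjunction, since the cardinals live on different types.\<close>

definition Cichon_above :: "'k rel \<Rightarrow> bool" where
  "Cichon_above \<kappa> \<longleftrightarrow>
    \<kappa> <o add_ideal null_ideal \<and>
    \<kappa> <o cov_ideal null_ideal \<and>
    \<kappa> <o non_ideal null_ideal \<and>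
    \<kappa> <o cof_ideal null_ideal \<and>
    \<kappa> <o add_ideal meager_ideal \<and>
    \<kappa> <o cov_ideal meager_ideal \<and>
    \<kappa> <o non_ideal meager_ideal \<and>
    \<kappa> <o cof_ideal meager_ideal \<and>
    \<kappa> <o bounding_number \<and>
    \<kappa> <o dominating_number"

lemma ideal_families_nonempty:
  assumes "UNIV \<notin> I" "\<And>x. {x} \<in> I"
  shows "{F. F \<subseteq> I \<and> \<Union>F \<notin> I} \<noteq> {}" "{F. F \<subseteq> I \<and> \<Union>F = UNIV} \<noteq> {}"
    "{X. X \<notin> I} \<noteq> {}" "{F. F \<subseteq> I \<and> (\<forall>X\<in>I. \<exists>Y\<in>F. X \<subseteq> Y)} \<noteq> {}"
proof -
  have "\<Union>I = UNIV" using assms(2) by blast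
  then show "{F. F \<subseteq> I \<and> \<Union>F \<notin> I} \<noteq> {}" "{F. F \<subseteq> I \<and> \<Union>F = UNIV} \<noteq> {}"
    using assms(1) by (auto intro!: exI[of _ I])
  show "{X. X \<notin> I} \<noteq> {}" "{F. F \<subseteq> I \<and> (\<forall>X\<in>I. \<exists>Y\<in>F. X \<subseteq> Y)} \<noteq> {}"
    using assms(1) by auto
qed

lemma null_ideal_proper: "UNIV \<notin> null_ideal" "{x} \<in> null_ideal"
  by (auto simp: null_ideal_def null_sets_def)

lemma meager_ideal_proper: "UNIV \<notin> meager_ideal" "{x} \<in> meager_ideal"
proof -
  show "UNIV \<notin> meager_ideal"
  proof
    assume "UNIV \<in> meager_ideal"
    then obtain S :: "nat \<Rightarrow> real set" where
      S: "\<And>n. nowhere_dense (S n)" "UNIV \<subseteq> (\<Union>n. S n)"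
      unfolding meager_ideal_def by auto
    have "UNIV \<subseteq> closure (\<Inter>(range (\<lambda>n. - closure (S n))))"
    proof (rule Baire)
      fix T assume "T \<in> range (\<lambda>n. - closure (S n))"
      then obtain n where "T = - closure (S n)" by blast
      then show "openin (top_of_set UNIV) T \<and> UNIV \<subseteq> closure T"
        using S(1)[of n] by (auto simp: nowhere_dense_def closure_complement)
    qed auto
    moreover have "\<Inter>(range (\<lambda>n. - closure (S n))) = {}"
    proof -
      have "x \<in> (\<Union>n. closure (S n))" for x
        using S(2) closure_subset[of "S _"] by (metis UNIV_I UN_iff subset_iff)
      then show ?thesis by auto
    qed
    ultimately show False by auto
  qed
  show "{x} \<in> meager_ideal"
    unfolding meager_ideal_def nowhere_dense_def by (auto intro!: exI[of _ "\<lambda>_. {x}"])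
qed

lemma bounding_family_nonempty: "{F. \<not> (\<exists>g. \<forall>f\<in>F. le_star f g)} \<noteq> {}"
proof -
  have "\<not> le_star (\<lambda>n. Suc (g n)) g" for g
    by (simp add: le_star_def)
  then show ?thesis by (auto intro!: exI[of _ UNIV])
qed

lemma dominating_family_nonempty: "{F. \<forall>g. \<exists>f\<in>F. le_star g f} \<noteq> {}"
proof -
  have "le_star g g" for g
    by (simp add: le_star_def)
  then show ?thesis by (auto intro!: exI[of _ UNIV])
qed

end

theory Submission
  imports Defs
begin

text \<open>
  The axioms say in particular that every \<open>aleph1\<close>-dense set \<open>B\<close> is covered by countably many
  1-Lipschitz images of any prescribed \<open>aleph1\<close>-dense set \<open>A\<close>, so smallness properties of \<open>A\<close>
  that pass to such images and to countable unions must hold of every \<open>B\<close>. If some family of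
  \<open>aleph1\<close> functions were unbounded modulo finite, \<open>A\<close> could be chosen concentrated on a countable
  set, whereas a set of the form \<open>X \<times> X\<close> is never concentrated; hence \<open>aleph1\<close> functions are always
  bounded. Given a bound, choose \<open>A\<close> with very few initial segments and let \<open>B\<close> code a given
  family of \<open>aleph1\<close> functions: counting initial segments of the images yields a slalom that
  localizes the family. By Bartoszynski's argument localization makes the unions of \<open>aleph1\<close> many
  null (meager) sets null (meager).
\<close>

section \<open>Cardinal arithmetic up to \<open>aleph1\<close>\<close>

lemma countable_iff_ordLeq_natLeq: "countable X \<longleftrightarrow> |X| \<le>o natLeq"
proof -
  have "countable X \<longleftrightarrow> |X| \<le>o |UNIV :: nat set|"
    unfolding countable_def card_of_ordLeq[symmetric] by auto
  then show ?thesis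
    using card_of_nat ordIso_symmetric ordLeq_ordIso_trans by blast
qed

lemma card_order_aleph1: "Card_order aleph1"
  by (simp add: cardSuc_Card_order natLeq_Card_order)

lemma infinite_Field_aleph1: "infinite (Field aleph1)"
  using cardSuc_finite[OF natLeq_Card_order] by (metis Field_natLeq infinite_UNIV_nat)

lemma ordLess_aleph1_iff_countable: "|X| <o aleph1 \<longleftrightarrow> countable X"
  by (simp add: countable_iff_ordLeq_natLeq cardSuc_ordLeq_ordLess card_of_Card_order natLeq_Card_order)

lemma countable_ordLeq_aleph1: "countable X \<Longrightarrow> |X| \<le>o aleph1"
  by (metis ordLess_aleph1_iff_countable ordLess_imp_ordLeq)

lemma ordIso_aleph1_iff: "|X| =o aleph1 \<longleftrightarrow> |X| \<le>o aleph1 \<and> uncountable X"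
  using ordLess_aleph1_iff_countable[of X] not_ordLess_ordIso[of "|X|" aleph1]
    ordLeq_iff_ordLess_or_ordIso[of "|X|" aleph1] by blast

lemma image_ordLeq_aleph1: "|X| \<le>o aleph1 \<Longrightarrow> |f ` X| \<le>o aleph1"
  using card_of_image ordLeq_transitive by blast

lemma subset_ordLeq_aleph1: "|X| \<le>o aleph1 \<Longrightarrow> Y \<subseteq> X \<Longrightarrow> |Y| \<le>o aleph1"
  using card_of_mono1 ordLeq_transitive by blast

lemma UN_ordLeq_aleph1:
  assumes "|I| \<le>o aleph1" "\<And>i. i \<in> I \<Longrightarrow> |A i| \<le>o aleph1"
  shows "|\<Union>i\<in>I. A i| \<le>o aleph1"
  by (rule card_of_UNION_ordLeq_infinite_Field)
    (use assms infinite_Field_aleph1 card_order_aleph1 in auto)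

lemma Times_ordLeq_aleph1:
  assumes "|X| \<le>o aleph1" "|Y| \<le>o aleph1"
  shows "|X \<times> Y| \<le>o aleph1"
  by (rule card_of_Times_ordLeq_infinite_Field)
    (use assms infinite_Field_aleph1 card_order_aleph1 in auto)

lemma Field_aleph1_ordIso: "|Field aleph1| =o aleph1"
  by (rule card_of_Field_ordIso[OF card_order_aleph1])


section \<open>Finite modifications\<close>

definition fin_mod :: "'a list \<Rightarrow> (nat \<Rightarrow> 'a) \<Rightarrow> (nat \<Rightarrow> 'a)" where
  "fin_mod s x = (\<lambda>i. if i < length s then s ! i else x i)"

text \<open>This closure makes a set of size \<open>aleph1\<close> dense, so that the axioms apply
  to it. It is a countable union of 1-Lipschitz images of the set when the alphabet is
  countable.\<close>

definition fin_mods :: "(nat \<Rightarrow> 'a) set \<Rightarrow> (nat \<Rightarrow> 'a) set" where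
  "fin_mods A = (\<Union>s. fin_mod s ` A)"

lemma Lip_fin_mod: "Lip (fin_mod s)"
  by (auto simp: Lip_def fin_mod_def agree_below_def)

lemma subset_fin_mods: "A \<subseteq> fin_mods A"
  by (force simp: fin_mods_def fin_mod_def intro!: exI[of _ "[]"])

lemma fin_mod_undo: "fin_mod (map x [0..<length s]) (fin_mod s x) = x"
  by (auto simp: fin_mod_def)

text \<open>\<open>fin_mod s\<close> need not be injective, but its fibres are countable: a preimage
  is recovered by restoring its first \<open>length s\<close> entries, for which there are countably
  many choices.\<close>

lemma uncountable_fin_mod_image:
  fixes A :: "(nat \<Rightarrow> 'a::countable) set"
  assumes "uncountable A"
  shows "uncountable (fin_mod s ` A)"
proof
  assume c: "countable (fin_mod s ` A)"
  have "x \<in> fin_mods (fin_mod s ` A)" if "x \<in> A" for x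
    unfolding fin_mods_def using fin_mod_undo[of x s] that by (metis UNIV_I UN_I imageI)
  moreover have "countable (fin_mods (fin_mod s ` A))"
    unfolding fin_mods_def using c by (intro countable_UN) auto
  ultimately show False
    using assms countable_subset[of A "fin_mods (fin_mod s ` A)"] by blast
qed

text \<open>A nonempty open set contains all sequences with some fixed prefix, hence the whole image
  of \<open>A\<close> under one \<open>fin_mod s\<close>.\<close>

lemma aleph1_dense_fin_mods:
  fixes A :: "(nat \<Rightarrow> 'a::{countable, discrete_topology}) set"
  assumes "|A| =o aleph1"
  shows "aleph1_dense (fin_mods A)"
  unfolding aleph1_dense_def
proof (intro allI impI, elim conjE)
  fix U :: "(nat \<Rightarrow> 'a) set"
  assume U: "open U" "U \<noteq> {}"
  have A: "|A| \<le>o aleph1" "uncountable A"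
    using assms by (auto simp: ordIso_aleph1_iff)
  have "|fin_mods A| \<le>o aleph1"
    unfolding fin_mods_def
    by (intro UN_ordLeq_aleph1 countable_ordLeq_aleph1 image_ordLeq_aleph1 A) auto
  moreover obtain x k where k: "\<And>y. agree_below k x y \<Longrightarrow> y \<in> U"
    using U open_iff_agree_below by blast
  have "fin_mod (map x [0..<k]) ` A \<subseteq> fin_mods A \<inter> U"
    using k unfolding fin_mods_def by (fastforce simp: agree_below_def fin_mod_def)
  then have "uncountable (fin_mods A \<inter> U)"
    using uncountable_fin_mod_image[OF A(2)] countable_subset by blast
  ultimately show "|fin_mods A \<inter> U| =o aleph1"
    by (auto simp: ordIso_aleph1_iff intro: subset_ordLeq_aleph1)
qed


section \<open>Concentrated sets\<close>

definition concentrated :: "'a::topological_space set \<Rightarrow> 'a set \<Rightarrow> bool" where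
  "concentrated A Q \<longleftrightarrow> countable Q \<and> (\<forall>U. open U \<and> Q \<subseteq> U \<longrightarrow> countable (A - U))"

lemma concentrated_Lip_image:
  fixes f :: "(nat \<Rightarrow> 'a::discrete_topology) \<Rightarrow> (nat \<Rightarrow> 'b::discrete_topology)"
  assumes f: "Lip f" and A: "concentrated A Q"
  shows "concentrated (f ` A) (f ` Q)"
  unfolding concentrated_def
proof (intro conjI allI impI)
  show "countable (f ` Q)"
    using A by (simp add: concentrated_def)
  fix U assume U: "open U \<and> f ` Q \<subseteq> U"
  have "open (f -` U)"
    using U f unfolding open_iff_agree_below Lip_def by (metis vimage_eq)
  then have "countable (A - f -` U)"
    using A U by (auto simp: concentrated_def)
  moreover have "f ` A - U \<subseteq> f ` (A - f -` U)"
    by auto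
  ultimately show "countable (f ` A - U)"
    using countable_image countable_subset by blast
qed

lemma concentrated_UN:
  assumes "countable I" "\<And>i. i \<in> I \<Longrightarrow> concentrated (A i) (Q i)"
  shows "concentrated (\<Union>i\<in>I. A i) (\<Union>i\<in>I. Q i)"
  unfolding concentrated_def
proof (intro conjI allI impI)
  show "countable (\<Union>i\<in>I. Q i)"
    using assms by (auto simp: concentrated_def)
  fix U assume "open U \<and> (\<Union>i\<in>I. Q i) \<subseteq> U"
  then have "countable (\<Union>i\<in>I. A i - U)"
    using assms by (intro countable_UN) (auto simp: concentrated_def)
  then show "countable ((\<Union>i\<in>I. A i) - U)"
    by (simp only: UN_simps)
qed

definition interleave :: "(nat \<Rightarrow> 'a) \<Rightarrow> (nat \<Rightarrow> 'a) \<Rightarrow> (nat \<Rightarrow> 'a)" where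
  "interleave x y = (\<lambda>i. if even i then x (i div 2) else y (i div 2))"

lemma interleave_eq_iff: "interleave x y = interleave x' y' \<longleftrightarrow> x = x' \<and> y = y'"
proof
  assume eq: "interleave x y = interleave x' y'"
  show "x = x' \<and> y = y'"
  proof (intro conjI ext)
    fix i
    show "x i = x' i"
      using fun_cong[OF eq, of "2 * i"] by (simp add: interleave_def)
    show "y i = y' i"
      using fun_cong[OF eq, of "2 * i + 1"] by (simp add: interleave_def)
  qed
qed auto

text \<open>A fibre over a point missed by the projection of \<open>Q\<close> is closed, disjoint from \<open>Q\<close>
  and meets the square in an uncountable set.\<close>

lemma not_concentrated_square:
  fixes X :: "(nat \<Rightarrow> 'a::discrete_topology) set"
  assumes X: "uncountable X"
    and sub: "(\<lambda>(x, y). interleave x y) ` (X \<times> X) \<subseteq> B"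
  shows "\<not> concentrated B Q"
proof
  assume Q: "concentrated B Q"
  then have "countable ((\<lambda>z i. z (2 * i)) ` Q)"
    by (simp add: concentrated_def)
  then obtain x where x: "x \<in> X" "x \<notin> (\<lambda>z i. z (2 * i)) ` Q"
    using X countable_subset[of X "(\<lambda>z i. z (2 * i)) ` Q"] by blast
  define U where "U = {z. (\<lambda>i. z (2 * i)) \<noteq> x}"
  have "open U"
    unfolding open_iff_agree_below
  proof
    fix z assume "z \<in> U"
    then obtain i where "z (2 * i) \<noteq> x i"
      by (auto simp: U_def)
    then show "\<exists>k. \<forall>y. agree_below k z y \<longrightarrow> y \<in> U"
      by (intro exI[of _ "Suc (2 * i)"]) (force simp: agree_below_def U_def)
  qed
  moreover have "Q \<subseteq> U"
    using x(2) by (auto simp: U_def)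
  ultimately have "countable (B - U)"
    using Q by (simp add: concentrated_def)
  moreover have "interleave x ` X \<subseteq> B - U"
    using sub x(1) by (auto simp: U_def interleave_def)
  moreover have "inj_on (interleave x) X"
    by (auto simp: inj_on_def interleave_eq_iff)
  ultimately show False
    using X by (metis countable_image_inj_on countable_subset)
qed


section \<open>Unbounded families\<close>

lemma countable_le_star_bounded:
  assumes "countable F"
  shows "\<exists>g. \<forall>f\<in>F. le_star f g"
proof (cases "F = {}")
  case False
  define e where "e = from_nat_into F"
  define g where "g n = Max ((\<lambda>i. e i n) ` {..n})" for n
  have "le_star f g" if f: "f \<in> F" for f
  proof -
    obtain i where "f = e i"
      using f assms by (metis e_def from_nat_into_to_nat_on)
    then have "f n \<le> g n" if "n \<ge> i" for n
      using that by (auto simp: g_def intro!: Max_ge)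
    then show ?thesis
      by (auto simp: le_star_def eventually_sequentially)
  qed
  then show ?thesis by blast
qed simp

lemma le_star_trans: "le_star f g \<Longrightarrow> le_star g h \<Longrightarrow> le_star f h"
  unfolding le_star_def by (erule (1) eventually_elim2) (rule order_trans)

text \<open>Along a well-order of type at most \<open>aleph1\<close> on \<open>F\<close>, let each new function dominate the
  countably many members of \<open>F\<close> below it.\<close>

lemma unbounded_scale:
  fixes F :: "(nat \<Rightarrow> nat) set"
  assumes F: "|F| \<le>o aleph1" "\<nexists>g. \<forall>f\<in>F. le_star f g"
  obtains G where "|G| =o aleph1" "\<And>h. countable {g \<in> G. le_star g h}"
proof -
  let ?r = "|F|"
  have wo: "Well_order ?r" and fld: "Field ?r = F"
    using card_of_Well_order[of F] by (auto simp: Field_card_of)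
  \<comment> \<open>Proper initial segments of the cardinal order \<open>|F|\<close> have size below
    \<open>aleph1\<close>.\<close>
  have cnt: "countable {f'. (f', f) \<in> ?r}" if "f \<in> F" for f
  proof -
    have "|underS ?r f| <o ?r"
      using that fld by (intro card_of_underS) (auto simp: card_of_card_order_on)
    then have "|underS ?r f| <o aleph1"
      using F(1) ordLess_ordLeq_trans by blast
    then have "countable (underS ?r f)"
      by (simp add: ordLess_aleph1_iff_countable)
    moreover have "{f'. (f', f) \<in> ?r} \<subseteq> insert f (underS ?r f)"
      by (auto simp: underS_def)
    ultimately show ?thesis
      by (metis countable_insert countable_subset)
  qed
  have "\<exists>h. \<forall>f'. (f', f) \<in> ?r \<longrightarrow> le_star f' h" if "f \<in> F" for f
    using countable_le_star_bounded[OF cnt[OF that]] by auto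
  then obtain b where b: "\<And>f f'. f \<in> F \<Longrightarrow> (f', f) \<in> ?r \<Longrightarrow> le_star f' (b f)"
    by metis
  have le: "countable {f \<in> F. le_star (b f) h}" for h
  proof (rule ccontr)
    assume unc: "uncountable {f \<in> F. le_star (b f) h}"
    have "le_star f' h" if f': "f' \<in> F" for f'
    proof -
      \<comment> \<open>An uncountable set does not fit into the countable segment up to
        \<open>f'\<close>, so some \<open>f\<close> with \<open>b f\<close> below \<open>h\<close>
        comes after \<open>f'\<close>; then \<open>b f\<close>, and with it \<open>h\<close>,
        dominates \<open>f'\<close>.\<close>
      obtain f where f: "f \<in> F" "le_star (b f) h" "(f, f') \<notin> ?r"
        using unc cnt[OF f'] countable_subset[of "{f \<in> F. le_star (b f) h}" "{f. (f, f') \<in> ?r}"]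
        by blast
      then have "(f', f) \<in> ?r"
        using wo_rel.TOTALS[of ?r] wo fld f' unfolding wo_rel_def by blast
      then show ?thesis
        using b f le_star_trans by blast
    qed
    then show False
      using F(2) by blast
  qed
  have "countable {g \<in> b ` F. le_star g h}" for h
  proof -
    have "{g \<in> b ` F. le_star g h} = b ` {f \<in> F. le_star (b f) h}"
      by auto
    then show ?thesis
      using le by simp
  qed
  \<comment> \<open>Otherwise a single \<open>h\<close> would bound every \<open>b f\<close>, so
    \<open>F\<close> would be countable by \<open>le\<close> and hence bounded.\<close>
  moreover have "uncountable (b ` F)"
  proof
    assume "countable (b ` F)"
    then obtain h where "\<And>f. f \<in> F \<Longrightarrow> le_star (b f) h"
      using countable_le_star_bounded[of "b ` F"] by auto
    then have "{f \<in> F. le_star (b f) h} = F"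
      by auto
    then show False
      using le[of h] F(2) countable_le_star_bounded[of F] by auto
  qed
  ultimately show ?thesis
    using that[of "b ` F"] F(1) by (simp add: ordIso_aleph1_iff image_ordLeq_aleph1)
qed

text \<open>Localization by a slalom. The width bounds the product \<open>Suc n * 2 ^ Suc n\<close>
  arising in \<open>localization\<close>, and it is small against the measures
  \<open>(1/8) ^ n\<close> of the coded sets.\<close>

definition localized :: "(nat \<Rightarrow> nat) set \<Rightarrow> bool" where
  "localized F \<longleftrightarrow> (\<exists>\<phi>. (\<forall>n. finite (\<phi> n) \<and> card (\<phi> n) \<le> 4 ^ Suc n) \<and>
    (\<forall>f\<in>F. \<forall>\<^sub>F n in sequentially. f n \<in> \<phi> n))"


section \<open>Consequences of the covering principle\<close>

definition seq_of :: "'a \<Rightarrow> 'a \<Rightarrow> nat set \<Rightarrow> (nat \<Rightarrow> 'a)" where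
  "seq_of a b T = (\<lambda>i. if i \<in> T then b else a)"

lemma inj_seq_of: "a \<noteq> b \<Longrightarrow> inj (seq_of a b)"
  by (auto simp: inj_def seq_of_def fun_eq_iff split: if_splits)

text \<open>As \<open>f (Suc n)\<close> exceeds \<open>f n\<close>, which is at least
  \<open>g n\<close>, its index in \<open>g\<close> exceeds \<open>n\<close>. Applied in both
  directions, this shows that a range determines its increasing enumeration.\<close>

lemma strict_mono_range_le:
  fixes f g :: "nat \<Rightarrow> nat"
  assumes f: "strict_mono f" and g: "strict_mono g" and sub: "range f \<subseteq> range g"
  shows "g n \<le> f n"
proof (induction n)
  case 0
  obtain j where "f 0 = g j"
    using sub by blast
  then show ?case
    using strict_mono_less_eq[OF g, of 0 j] by simp
next
  case (Suc n)
  obtain j where j: "f (Suc n) = g j"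
    using sub by blast
  have "g n < g j"
    using Suc strict_mono_less[OF f, of n "Suc n"] j by linarith
  then show ?case
    using strict_mono_less[OF g] strict_mono_less_eq[OF g] j by simp
qed

text \<open>The common content of the two axioms that the argument uses.\<close>

locale Lip_cover =
  fixes a b :: "'a::{countable, discrete_topology}"
  assumes neq: "a \<noteq> b"
    and cover: "\<And>A B :: (nat \<Rightarrow> 'a) set. aleph1_dense A \<Longrightarrow> aleph1_dense B \<Longrightarrow>
      \<exists>f :: nat \<Rightarrow> (nat \<Rightarrow> 'a) \<Rightarrow> (nat \<Rightarrow> 'a). (\<forall>n. Lip (f n)) \<and> B = (\<Union>n. f n ` A)"
begin

text \<open>The square of \<open>A\<close>, coded by \<open>interleave\<close>, again has size
  \<open>aleph1\<close>, so countably many Lipschitz images of modifications of \<open>A\<close>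
  cover it. Such images and unions preserve concentration, which the square cannot have.\<close>

lemma not_concentrated:
  fixes A :: "(nat \<Rightarrow> 'a) set"
  assumes A: "|A| =o aleph1"
  shows "\<not> concentrated A Q"
proof
  assume conc: "concentrated A Q"
  define S where "S = (\<lambda>(x, y). interleave x y) ` (A \<times> A)"
  have A': "|A| \<le>o aleph1" "uncountable A"
    using A by (auto simp: ordIso_aleph1_iff)
  have "uncountable S"
  proof
    assume "countable S"
    moreover have "inj_on (\<lambda>(x, y). interleave x y) (A \<times> A)"
      by (auto simp: inj_on_def interleave_eq_iff)
    ultimately have "countable (A \<times> A)"
      using countable_image_inj_on unfolding S_def by blast
    then have "countable (fst ` (A \<times> A))"
      by (rule countable_image)
    with A'(2) show False
      by (simp add: fst_image_times split: if_splits)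
  qed
  moreover have "|S| \<le>o aleph1"
    unfolding S_def by (intro image_ordLeq_aleph1 Times_ordLeq_aleph1 A')
  ultimately have "aleph1_dense (fin_mods S)"
    by (simp add: aleph1_dense_fin_mods ordIso_aleph1_iff)
  then obtain f :: "nat \<Rightarrow> (nat \<Rightarrow> 'a) \<Rightarrow> (nat \<Rightarrow> 'a)"
    where f: "\<And>n. Lip (f n)" "fin_mods S = (\<Union>n. f n ` fin_mods A)"
    using cover[OF aleph1_dense_fin_mods[OF A]] by blast
  have "concentrated (\<Union>n. f n ` (\<Union>s. fin_mod s ` A)) (\<Union>n. f n ` (\<Union>s. fin_mod s ` Q))"
    by (intro concentrated_UN concentrated_Lip_image f Lip_fin_mod conc) auto
  then have "concentrated (fin_mods S) (\<Union>n. f n ` (\<Union>s. fin_mod s ` Q))"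
    unfolding f(2) by (simp add: fin_mods_def)
  moreover have "(\<lambda>(x, y). interleave x y) ` (A \<times> A) \<subseteq> fin_mods S"
    using subset_fin_mods[of S] by (simp add: S_def)
  ultimately show False
    using not_concentrated_square[OF A'(2)] by blast
qed

text \<open>If a family is unbounded, the strictly increasing enumerations \<open>h g\<close> of sparse sets
  built from a scale give a set concentrated on the eventually constant sequences: a
  neighbourhood of these yields a bound \<open>K\<close> on the gaps of every set whose sequence
  lies outside of it.\<close>

lemma le_star_bounded:
  fixes F :: "(nat \<Rightarrow> nat) set"
  assumes F: "|F| \<le>o aleph1"
  shows "\<exists>g. \<forall>f\<in>F. le_star f g"
proof (rule ccontr)
  assume "\<nexists>g. \<forall>f\<in>F. le_star f g"
  then obtain G where G: "|G| =o aleph1" "\<And>h. countable {g \<in> G. le_star g h}"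
    using unbounded_scale[OF F] by blast
  \<comment> \<open>These sums are strictly increasing, dominate \<open>g\<close> and determine
    it.\<close>
  define h where "h g n = (\<Sum>i\<le>n. Suc (g i))" for g :: "nat \<Rightarrow> nat" and n
  define x where "x g = seq_of a b (range (h g))" for g
  define Q where "Q = range (\<lambda>s. fin_mod s (\<lambda>_. a))"
  have le_h: "g n \<le> h g n" for g n
    using member_le_sum[of n "{..n}" "\<lambda>i. Suc (g i)"] by (simp add: h_def)
  have h_Suc: "h g (Suc n) = h g n + Suc (g (Suc n))" for g n
    by (simp add: h_def)
  have mono_h: "strict_mono (h g)" for g
    by (simp add: strict_mono_Suc_iff h_Suc)
  have inj_h: "g = g'" if eq: "h g = h g'" for g g'
  proof
    fix n
    show "g n = g' n"
      using fun_cong[OF eq, of n] fun_cong[OF eq, of "n - 1"] by (cases n) (auto simp: h_def)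
  qed
  have inj_x: "inj x"
  proof (rule injI)
    fix g g' assume "x g = x g'"
    then have "range (h g) = range (h g')"
      unfolding x_def by (rule injD[OF inj_seq_of[OF neq]])
    then have "h g n \<le> h g' n" "h g' n \<le> h g n" for n
      using strict_mono_range_le[OF mono_h[of g] mono_h[of g']]
        strict_mono_range_le[OF mono_h[of g'] mono_h[of g]] by auto
    then have "h g = h g'"
      by (intro ext antisym)
    then show "g = g'"
      by (rule inj_h)
  qed
  have "concentrated (x ` G) Q"
    unfolding concentrated_def
  proof (intro conjI allI impI)
    show "countable Q"
      by (simp add: Q_def)
    fix U assume U: "open U \<and> Q \<subseteq> U"
    have "fin_mod s (\<lambda>_. a) \<in> U" for s
      using U by (auto simp: Q_def)
    then have "\<exists>k. \<forall>y. agree_below k (fin_mod s (\<lambda>_. a)) y \<longrightarrow> y \<in> U" for s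
      using U open_iff_agree_below[of U] by blast
    then obtain k where k: "\<And>s y. agree_below (k s) (fin_mod s (\<lambda>_. a)) y \<Longrightarrow> y \<in> U"
      by metis
    \<comment> \<open>Only the values \<open>a\<close> and \<open>b\<close> occur in
      \<open>x g\<close>, so finitely many prefixes matter even over an infinite alphabet.\<close>
    define L where "L n = {s. set s \<subseteq> {a, b} \<and> length s \<le> n}" for n :: nat
    have fin_L: "finite (L n)" for n
      unfolding L_def by (rule finite_lists_length_le) simp
    define K where "K n = Max (k ` L n)" for n
    have k_le: "k s \<le> K n" if "s \<in> L n" for s n
      using that fin_L[of n] by (simp add: K_def)
    have K_mono: "K m \<le> K n" if "m \<le> n" for m n
      unfolding K_def using that fin_L by (intro Max_mono) (auto simp: L_def intro: exI[of _ "[]"])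
    \<comment> \<open>If \<open>range (h g)\<close> missed the interval, \<open>x g\<close> would
      continue its prefix of length \<open>n\<close> with \<open>a\<close> for long enough to fall
      into \<open>U\<close>.\<close>
    have gap: "\<exists>i. i \<in> range (h g) \<and> n \<le> i \<and> i < K n" if "x g \<notin> U" for g n
    proof (rule ccontr)
      assume no: "\<nexists>i. i \<in> range (h g) \<and> n \<le> i \<and> i < K n"
      define s where "s = map (x g) [0..<n]"
      have "s \<in> L n"
        by (auto simp: s_def L_def x_def seq_of_def)
      then have "i \<in> range (h g) \<Longrightarrow> i < k s \<Longrightarrow> i < n" for i
        using no k_le[of s n] by (meson leI order_less_le_trans)
      then have "agree_below (k s) (fin_mod s (\<lambda>_. a)) (x g)"
        by (simp add: agree_below_def fin_mod_def s_def x_def seq_of_def)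
      then show False
        using k that by blast
    qed
    \<comment> \<open>Iterated gap bound: the element of \<open>range (h g)\<close> following
      \<open>h g n\<close> lies below \<open>K (Suc (h g n))\<close>.\<close>
    define B where "B = rec_nat (K 0) (\<lambda>_ m. K (Suc m))"
    have h_le: "h g n \<le> B n" if g: "x g \<notin> U" for g n
    proof (induction n)
      case 0
      obtain m where "h g m < K 0"
        using gap[OF g, of 0] by auto
      then show ?case
        using strict_mono_mono[OF mono_h, of g] monoD[of "h g" 0 m] by (auto simp: B_def)
    next
      case (Suc n)
      obtain m where m: "Suc (h g n) \<le> h g m" "h g m < K (Suc (h g n))"
        using gap[OF g, of "Suc (h g n)"] by auto
      then have "Suc n \<le> m"
        using strict_mono_less[OF mono_h, of g n m] by simp
      then have "h g (Suc n) \<le> h g m"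
        using strict_mono_less_eq[OF mono_h] by blast
      also have "\<dots> \<le> K (Suc (B n))"
        using m(2) K_mono[of "Suc (h g n)" "Suc (B n)"] Suc by simp
      finally show ?case
        by (simp add: B_def)
    qed
    have "x ` G - U \<subseteq> x ` {g \<in> G. le_star g B}"
    proof safe
      fix g assume g: "g \<in> G" "x g \<notin> U"
      then have "le_star g B"
        unfolding le_star_def by (intro always_eventually allI order_trans[OF le_h h_le])
      then show "x g \<in> x ` {g \<in> G. le_star g B}"
        using g by blast
    qed
    then show "countable (x ` G - U)"
      by (rule countable_subset[OF _ countable_image[OF G(2)]])
  qed
  moreover have "|x ` G| =o aleph1"
    using G(1) countable_image_inj_on[of x G] inj_on_subset[OF inj_x]
    by (auto simp: ordIso_aleph1_iff image_ordLeq_aleph1)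
  ultimately show False
    using not_concentrated by blast
qed

text \<open>The set \<open>A\<close> consists of sequences that are free only on the sparse set \<open>range p\<close>, so it
  has at most \<open>2 ^ Suc n\<close> initial segments of length \<open>p (Suc n)\<close>, and 1-Lipschitz images
  inherit this.\<close>

lemma localization:
  fixes F :: "(nat \<Rightarrow> nat) set"
  assumes F: "|F| \<le>o aleph1"
  shows "localized F"
proof -
  obtain g where g: "\<And>f. f \<in> F \<Longrightarrow> le_star f g"
    using le_star_bounded[OF F] by blast
  \<comment> \<open>Block \<open>n\<close> runs from \<open>p n\<close> to \<open>p n + g n\<close>,
    with one position for each value up to \<open>g n\<close>.\<close>
  define p where "p n = (\<Sum>i<n. Suc (g i))" for n
  have p_Suc: "p (Suc n) = p n + Suc (g n)" for n
    by (simp add: p_def)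
  have mono_p: "strict_mono p"
    by (simp add: strict_mono_Suc_iff p_Suc)
  \<comment> \<open>The field of \<open>aleph1\<close> is itself a family of sets of naturals and
    supplies \<open>aleph1\<close> many parameters.\<close>
  define W :: "nat set set" where "W = Field aleph1"
  define A where "A = (\<lambda>T. seq_of a b (p ` T)) ` W"
  \<comment> \<open>A single \<open>b\<close> in block \<open>n\<close> marks the value
    \<open>f n\<close>. Truncation keeps the mark inside its block and, for \<open>f\<close> in
    \<open>F\<close>, changes only finitely many values.\<close>
  define code where "code f = seq_of a b (range (\<lambda>n. p n + min (f n) (g n)))" for f
  define decode where "decode n x = (LEAST v. x (p n + v) = b)" for n and x :: "nat \<Rightarrow> 'a"
  \<comment> \<open>Adding \<open>A\<close> makes \<open>D\<close> uncountable even if there are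
    only countably many codes.\<close>
  define D where "D = code ` F \<union> A"
  have inj_A: "inj (\<lambda>T. seq_of a b (p ` T))"
    by (intro injI) (metis inj_image_eq_iff inj_seq_of[OF neq, THEN injD] strict_mono_imp_inj_on[OF mono_p])
  have A: "|A| =o aleph1"
    using Field_aleph1_ordIso countable_image_inj_on[of "\<lambda>T. seq_of a b (p ` T)" W] inj_on_subset[OF inj_A]
    by (auto simp: ordIso_aleph1_iff image_ordLeq_aleph1 A_def W_def)
  have "|D| \<le>o aleph1"
    unfolding D_def using A F
    by (intro card_of_Un_ordLeq_infinite_Field infinite_Field_aleph1 card_order_aleph1 image_ordLeq_aleph1)
      (auto simp: ordIso_aleph1_iff)
  moreover have "uncountable D"
    using A by (auto simp: D_def ordIso_aleph1_iff)
  ultimately have "aleph1_dense (fin_mods D)"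
    by (simp add: aleph1_dense_fin_mods ordIso_aleph1_iff)
  then obtain f0 :: "nat \<Rightarrow> (nat \<Rightarrow> 'a) \<Rightarrow> (nat \<Rightarrow> 'a)"
    where f0: "\<And>n. Lip (f0 n)" "fin_mods D = (\<Union>n. f0 n ` fin_mods A)"
    using cover[OF aleph1_dense_fin_mods[OF A]] by blast
  define e where "e m = (case from_nat m of (i, s) \<Rightarrow> f0 i \<circ> fin_mod s)" for m
  have "Lip (f0 i \<circ> fin_mod s)" for i s
    using f0(1)[of i] Lip_fin_mod[of s] unfolding Lip_def comp_def by blast
  then have Lip_e: "Lip (e m)" for m
    by (simp add: e_def split: prod.split)
  have cov: "\<exists>m. x \<in> e m ` A" if "x \<in> D" for x
  proof -
    have "x \<in> (\<Union>n. f0 n ` fin_mods A)"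
      using that subset_fin_mods[of D] f0(2) by blast
    then obtain i s y where "y \<in> A" "x = f0 i (fin_mod s y)"
      by (auto simp: fin_mods_def)
    then have "x = e (to_nat (i, s)) y"
      by (simp add: e_def)
    then show ?thesis
      using \<open>y \<in> A\<close> by blast
  qed
  \<comment> \<open>Representatives for the initial segments of length \<open>p (Suc n)\<close>:
    within these only the positions \<open>p 0\<close> to \<open>p n\<close> are free.\<close>
  define R where "R n = (\<lambda>T. seq_of a b (p ` T)) ` Pow {..n}" for n
  have R: "\<exists>r\<in>R n. agree_below (p (Suc n)) y r" if yA: "y \<in> A" for y n
  proof -
    obtain T where y: "y = seq_of a b (p ` T)"
      using yA by (auto simp: A_def)
    have "agree_below (p (Suc n)) y (seq_of a b (p ` (T \<inter> {..n})))"
      using strict_mono_less[OF mono_p] by (force simp: y agree_below_def seq_of_def less_Suc_eq_le)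
    then show ?thesis
      by (auto simp: R_def)
  qed
  have fin_R: "finite (R n)" for n
    by (simp add: R_def)
  have card_R: "card (R n) \<le> 2 ^ Suc n" for n
    using card_image_le[of "Pow {..n}" "\<lambda>T. seq_of a b (p ` T)"] by (simp add: R_def card_Pow)
  define \<phi> where "\<phi> n = (\<Union>m\<le>n. (\<lambda>r. decode n (e m r)) ` R n)" for n
  have "finite (\<phi> n)" for n
    using fin_R by (simp add: \<phi>_def)
  moreover have "card (\<phi> n) \<le> 4 ^ Suc n" for n
  proof -
    have "card (\<phi> n) \<le> (\<Sum>m\<le>n. card ((\<lambda>r. decode n (e m r)) ` R n))"
      unfolding \<phi>_def by (rule card_UN_le) simp
    also have "\<dots> \<le> (\<Sum>m\<le>n. 2 ^ Suc n)"
      using card_image_le[OF fin_R] card_R order_trans by (intro sum_mono) blast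
    also have "\<dots> = Suc n * 2 ^ Suc n"
      by simp
    also have "\<dots> \<le> 2 ^ Suc n * 2 ^ Suc n"
      by (intro mult_right_mono less_imp_le[OF less_exp]) simp
    also have "\<dots> = 4 ^ Suc n"
      by (simp flip: power_mult_distrib)
    finally show ?thesis .
  qed
  moreover have "\<forall>\<^sub>F n in sequentially. f n \<in> \<phi> n" if f: "f \<in> F" for f
  proof -
    obtain m y where m: "y \<in> A" "code f = e m y"
      using cov[of "code f"] f by (auto simp: D_def)
    have "f n \<in> \<phi> n" if n: "m \<le> n" "f n \<le> g n" for n
    proof -
      obtain r where r: "r \<in> R n" "agree_below (p (Suc n)) y r"
        using R[OF m(1)] by blast
      \<comment> \<open>The Lipschitz constant 1 matters here: length \<open>p (Suc n)\<close> ends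
        exactly with block \<open>n\<close>, so the image of \<open>r\<close> shows the whole block
        of \<open>code f\<close>.\<close>
      then have agree: "agree_below (p (Suc n)) (code f) (e m r)"
        using Lip_e m(2) by (simp add: Lip_def)
      have code: "code f (p n + v) = b \<longleftrightarrow> v = f n" if "v \<le> g n" for v
      proof -
        have same: "i = n" if eq: "p n + v = p i + min (f i) (g i)" for i
        proof -
          have "p i < p (Suc n)" "p n < p (Suc i)"
            using eq \<open>v \<le> g n\<close> by (auto simp: p_Suc)
          then show ?thesis
            using strict_mono_less[OF mono_p] by (simp add: less_Suc_eq_le)
        qed
        have "p n + v \<in> range (\<lambda>n. p n + min (f n) (g n)) \<longleftrightarrow> v = f n"
        proof
          assume "p n + v \<in> range (\<lambda>n. p n + min (f n) (g n))"
          then obtain i where i: "p n + v = p i + min (f i) (g i)"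
            by auto
          show "v = f n"
            using i n(2) unfolding same[OF i] by simp
        next
          assume "v = f n"
          then show "p n + v \<in> range (\<lambda>n. p n + min (f n) (g n))"
            using n(2) by (intro range_eqI[of _ _ n]) simp
        qed
        then show ?thesis
          using neq by (simp add: code_def seq_of_def)
      qed
      have er: "e m r (p n + v) = b \<longleftrightarrow> v = f n" if "v \<le> g n" for v
        using code[OF that] agree that by (simp add: agree_below_def p_Suc)
      have "decode n (e m r) = f n"
        unfolding decode_def
      proof (rule Least_equality)
        show "e m r (p n + f n) = b"
          using er n(2) by blast
        show "f n \<le> y" if "e m r (p n + y) = b" for y
          using er[of y] n(2) that by (cases "y \<le> g n") auto
      qed
      then have "f n \<in> (\<lambda>r. decode n (e m r)) ` R n"
        using r(1) by (intro image_eqI[of _ _ r]) simp_all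
      then show ?thesis
        using n(1) by (auto simp: \<phi>_def)
    qed
    then show ?thesis
      using eventually_conj[OF eventually_ge_at_top[of m] g[OF f, unfolded le_star_def]]
      by (auto elim: eventually_mono)
  qed
  ultimately show ?thesis
    unfolding localized_def by blast
qed

end


section \<open>Null sets\<close>

text \<open>Codes stand for finite unions of differences of base sets. Such differences partition open
  sets \<open>U k\<close> of measure at most \<open>(1/2) ^ k\<close> containing \<open>N\<close>; as the measures of all pieces have a
  finite sum, the pieces can be grouped into consecutive blocks of rapidly decreasing measure.\<close>

lemma null_set_codes:
  obtains E :: "nat \<Rightarrow> real set" where
    "\<And>c. E c \<in> sets lborel"
    "\<And>N. N \<in> null_sets lebesgue \<Longrightarrow>
      \<exists>f. \<forall>n. emeasure lborel (E (f n)) \<le> ennreal ((1/8) ^ n) \<and>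
        (\<forall>x\<in>N. \<exists>\<^sub>F n in sequentially. x \<in> E (f n))"
proof -
  obtain \<B> :: "real set set" where \<B>: "countable \<B>" "topological_basis \<B>"
    using ex_countable_basis by blast
  have "\<B> \<noteq> {}"
    using topological_basisE[OF \<B>(2) open_UNIV UNIV_I] by auto
  define b where "b = from_nat_into \<B>"
  have range_b: "range b = \<B>"
    using \<B>(1) \<open>\<B> \<noteq> {}\<close> by (simp add: b_def range_from_nat_into)
  have open_b: "open (b i)" for i
    using topological_basis_open[OF \<B>(2), of "b i"] range_b by blast
  define E0 where "E0 = (\<lambda>(P, L). (\<Union>i\<in>set P. b i) - (\<Union>i\<in>set L. b i))"
  define E where "E c = (\<Union>z\<in>set (from_nat c). E0 z)" for c
  have E0_sets: "E0 z \<in> sets lborel" for z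
    using open_b by (cases z) (auto simp: E0_def intro!: borel_open)
  have E_sets: "E c \<in> sets lborel" for c
    unfolding E_def using E0_sets by (intro sets.finite_UN) auto
  show ?thesis
  proof (rule that[of E, OF E_sets])
    fix N :: "real set" assume N: "N \<in> null_sets lebesgue"
    have "\<exists>U. open U \<and> N \<subseteq> U \<and> emeasure lborel U \<le> ennreal ((1/2) ^ k)" for k :: nat
    proof -
      have "N \<in> sets lebesgue" "0 < (1/2 :: real) ^ k"
        using N by auto
      then obtain U where U: "open U" "N \<subseteq> U" "emeasure lebesgue (U - N) < ennreal ((1/2) ^ k)"
        using sets_lebesgue_outer_open by meson
      have "emeasure lborel U = emeasure lebesgue (U - N)"
        using U(1) N by (simp add: emeasure_Diff_null_set)
      then show ?thesis
        using U by (intro exI[of _ U]) simp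
    qed
    then obtain U where U: "\<And>k. open (U k)" "\<And>k. N \<subseteq> U k"
      "\<And>k. emeasure lborel (U k) \<le> ennreal ((1/2) ^ k)"
      by metis
    \<comment> \<open>Codes for the disjointed sequence of base sets inside \<open>U k\<close>, an
      empty first list giving the empty piece. By disjointness the measures of the pieces add up to
      that of \<open>U k\<close>.\<close>
    define z where "z k j = (if b j \<subseteq> U k then [j] else [], filter (\<lambda>i. b i \<subseteq> U k) [0..<j])" for k j
    have E0_z: "E0 (z k j) = disjointed (\<lambda>j. if b j \<subseteq> U k then b j else {}) j" for k j
      by (auto simp: E0_def z_def disjointed_def)
    have UN_z: "(\<Union>j. E0 (z k j)) = U k" for k
    proof -
      have "x \<in> (\<Union>j. if b j \<subseteq> U k then b j else {})" if xU: "x \<in> U k" for x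
      proof -
        obtain j where "x \<in> b j" "b j \<subseteq> U k"
          using topological_basisE[OF \<B>(2) U(1) xU] range_b by (metis imageE)
        then show ?thesis
          by auto
      qed
      then show ?thesis
        unfolding E0_z UN_disjointed_eq by (auto split: if_splits)
    qed
    have "disjoint_family (\<lambda>j. E0 (z k j))" for k
      unfolding E0_z by (rule disjoint_family_disjointed)
    moreover have "range (\<lambda>j. E0 (z k j)) \<subseteq> sets lborel" for k
      using E0_sets by blast
    ultimately have sum_z: "(\<Sum>j. emeasure lborel (E0 (z k j))) = emeasure lborel (U k)" for k
      using suminf_emeasure[of "\<lambda>j. E0 (z k j)" lborel] by (simp only: UN_z)
    define w where "w i = (\<lambda>(k, j). z k j) (prod_decode i)" for i
    define \<mu> where "\<mu> i = measure lborel (E0 (w i))" for i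
    have \<mu>_nonneg: "0 \<le> \<mu> i" for i
      by (simp add: \<mu>_def)
    have sum_w: "(\<Sum>i. emeasure lborel (E0 (w i))) < top"
    proof -
      have "(\<Sum>i. emeasure lborel (E0 (w i))) = (\<Sum>k. emeasure lborel (U k))"
        unfolding w_def
        using suminf_ennreal_2dimen[of "\<lambda>k. emeasure lborel (U k)" "\<lambda>(k, j). emeasure lborel (E0 (z k j))"]
        by (simp add: sum_z split_beta)
      also have "\<dots> \<le> (\<Sum>k. ennreal ((1/2) ^ k))"
        by (intro suminf_le U summableI)
      also have "\<dots> = ennreal (\<Sum>k. (1/2) ^ k)"
        by (intro suminf_ennreal2) (auto intro: summable_geometric)
      finally show ?thesis
        using ennreal_less_top order_le_less_trans by blast
    qed
    have em: "emeasure lborel (E0 (w i)) = ennreal (\<mu> i)" for i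
    proof -
      have "emeasure lborel (E0 (w i)) \<le> (\<Sum>i. emeasure lborel (E0 (w i)))"
        using sum_le_suminf[of "\<lambda>i. emeasure lborel (E0 (w i))" "{i}"] by (simp add: summableI)
      then show ?thesis
        using sum_w unfolding \<mu>_def by (intro emeasure_eq_ennreal_measure) auto
    qed
    have sm: "summable \<mu>"
      using sum_w by (intro summable_suminf_not_top) (auto simp: em \<mu>_def)
    have "\<exists>M. \<forall>m\<ge>M. norm (\<Sum>i. \<mu> (i + m)) < (1/8) ^ n" for n :: nat
      using suminf_exist_split[OF _ sm] by simp
    then obtain M where M: "\<And>n m. m \<ge> M n \<Longrightarrow> norm (\<Sum>i. \<mu> (i + m)) < (1/8) ^ n"
      by metis
    \<comment> \<open>Block \<open>n\<close> starts at or beyond \<open>M n\<close>, where the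
      remaining sum is already below \<open>(1/8) ^ n\<close>.\<close>
    define \<nu> where "\<nu> n = (\<Sum>k\<le>n. Suc (M k))" for n
    have mono_\<nu>: "strict_mono \<nu>"
      by (simp add: strict_mono_Suc_iff \<nu>_def)
    have M_le: "M n \<le> \<nu> n" for n
      using member_le_sum[of n "{..n}" "\<lambda>k. Suc (M k)"] by (simp add: \<nu>_def)
    define f where "f n = to_nat (map w [\<nu> n..<\<nu> (Suc n)])" for n
    have E_f: "E (f n) = (\<Union>i\<in>{\<nu> n..<\<nu> (Suc n)}. E0 (w i))" for n
      by (simp add: E_def f_def)
    have "emeasure lborel (E (f n)) \<le> ennreal ((1/8) ^ n)" for n
    proof -
      have "emeasure lborel (E (f n)) \<le> (\<Sum>i\<in>{\<nu> n..<\<nu> (Suc n)}. emeasure lborel (E0 (w i)))"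
        unfolding E_f by (intro emeasure_subadditive_finite image_subsetI E0_sets) simp
      also have "\<dots> = ennreal (\<Sum>i\<in>{\<nu> n..<\<nu> (Suc n)}. \<mu> i)"
        unfolding em by (rule sum_ennreal) (rule \<mu>_nonneg)
      also have "(\<Sum>i\<in>{\<nu> n..<\<nu> (Suc n)}. \<mu> i) = (\<Sum>i<\<nu> (Suc n) - \<nu> n. \<mu> (i + \<nu> n))"
        using sum.shift_bounds_nat_ivl[of \<mu> 0 "\<nu> n" "\<nu> (Suc n) - \<nu> n"]
          strict_mono_less_eq[OF mono_\<nu>, of n "Suc n"]
        by (simp add: atLeast0LessThan)
      also have "\<dots> \<le> (\<Sum>i. \<mu> (i + \<nu> n))"
        by (intro sum_le_suminf) (simp_all add: sm summable_iff_shift \<mu>_nonneg)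
      also have "\<dots> \<le> (1/8) ^ n"
        using M[OF M_le, of n] by simp
      finally show ?thesis
        by (simp add: ennreal_leI)
    qed
    moreover have "\<exists>\<^sub>F n in sequentially. x \<in> E (f n)" if x: "x \<in> N" for x
      unfolding frequently_sequentially
    proof
      fix n0
      \<comment> \<open>Since \<open>prod_encode\<close> dominates its first argument, a piece of
        \<open>U (\<nu> n0)\<close> has index at least \<open>\<nu> n0\<close> and so belongs to a
        block from \<open>n0\<close> on.\<close>
      obtain j where j: "x \<in> E0 (z (\<nu> n0) j)"
        using x U(2) UN_z[of "\<nu> n0"] by blast
      define i where "i = prod_encode (\<nu> n0, j)"
      have i: "\<nu> n0 \<le> i" "x \<in> E0 (w i)"
        using j by (auto simp: i_def w_def le_prod_encode_1)
      have "\<exists>n\<ge>n0. \<nu> n \<le> i \<and> i < \<nu> (Suc n)"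
      proof (rule ccontr)
        assume no: "\<nexists>n. n \<ge> n0 \<and> \<nu> n \<le> i \<and> i < \<nu> (Suc n)"
        have "\<nu> (n0 + m) \<le> i" for m
          by (induction m) (use i no in \<open>auto simp: not_less\<close>)
        then have "\<nu> (n0 + Suc i) \<le> i"
          by blast
        moreover have "n0 + Suc i \<le> \<nu> (n0 + Suc i)"
          using mono_\<nu> by (rule strict_mono_imp_increasing)
        ultimately show False
          by simp
      qed
      then obtain n where "n0 \<le> n" "i \<in> {\<nu> n..<\<nu> (Suc n)}"
        by auto
      then show "\<exists>n\<ge>n0. x \<in> E (f n)"
        using i(2) unfolding E_f by blast
    qed
    ultimately show "\<exists>f. \<forall>n. emeasure lborel (E (f n)) \<le> ennreal ((1/8) ^ n) \<and>
        (\<forall>x\<in>N. \<exists>\<^sub>F n in sequentially. x \<in> E (f n))"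
      by blast
  qed
qed

text \<open>Localize the code sequences of the null sets. At \<open>n\<close> at most
  \<open>4 ^ Suc n\<close> sets of measure at most \<open>(1/8) ^ n\<close> are united; the
  resulting bounds \<open>4 * (1/2) ^ n\<close> are summable, and Borel-Cantelli makes the limsup
  null.\<close>

lemma Union_null_ideal:
  assumes loc: "\<And>F. |F| \<le>o aleph1 \<Longrightarrow> localized F"
    and I: "\<N> \<subseteq> null_ideal" "|\<N>| \<le>o aleph1"
  shows "\<Union>\<N> \<in> null_ideal"
proof -
  obtain E :: "nat \<Rightarrow> real set" where E: "\<And>c. E c \<in> sets lborel"
    "\<And>N. N \<in> null_sets lebesgue \<Longrightarrow>
      \<exists>f. \<forall>n. emeasure lborel (E (f n)) \<le> ennreal ((1/8) ^ n) \<and>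
        (\<forall>x\<in>N. \<exists>\<^sub>F n in sequentially. x \<in> E (f n))"
    using null_set_codes by blast
  then obtain f where f: "\<And>N n. N \<in> \<N> \<Longrightarrow> emeasure lborel (E (f N n)) \<le> ennreal ((1/8) ^ n)"
    "\<And>N x. N \<in> \<N> \<Longrightarrow> x \<in> N \<Longrightarrow> \<exists>\<^sub>F n in sequentially. x \<in> E (f N n)"
    using I(1) unfolding null_ideal_def by (metis subsetD)
  obtain \<phi> where \<phi>: "\<And>n. finite (\<phi> n)" "\<And>n. card (\<phi> n) \<le> 4 ^ Suc n"
    "\<And>N. N \<in> \<N> \<Longrightarrow> \<forall>\<^sub>F n in sequentially. f N n \<in> \<phi> n"
    using loc[OF image_ordLeq_aleph1[OF I(2), of f]] unfolding localized_def by blast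
  \<comment> \<open>Candidates of too large measure are discarded; genuine codes survive.\<close>
  define C where "C n = {c \<in> \<phi> n. emeasure lborel (E c) \<le> ennreal ((1/8) ^ n)}" for n
  define A where "A n = (\<Union>c\<in>C n. E c)" for n
  have fin_C: "finite (C n)" for n
    using \<phi>(1) by (simp add: C_def)
  have A_sets: "A n \<in> sets lborel" for n
    unfolding A_def using E(1) fin_C by (intro sets.finite_UN) auto
  have A_le: "emeasure lborel (A n) \<le> ennreal (4 * (1/2) ^ n)" for n
  proof -
    have "emeasure lborel (A n) \<le> (\<Sum>c\<in>C n. emeasure lborel (E c))"
      unfolding A_def using E(1) fin_C by (intro emeasure_subadditive_finite) auto
    also have "\<dots> \<le> (\<Sum>c\<in>C n. ennreal ((1/8) ^ n))"
      by (intro sum_mono) (simp add: C_def)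
    also have "\<dots> = ennreal (real (card (C n)) * (1/8) ^ n)"
      by (simp add: ennreal_mult ennreal_of_nat_eq_real_of_nat)
    also have "\<dots> \<le> ennreal (4 ^ Suc n * (1/8) ^ n)"
    proof (intro ennreal_leI mult_right_mono)
      have "card (C n) \<le> card (\<phi> n)"
        using \<phi>(1) by (intro card_mono) (auto simp: C_def)
      with \<phi>(2)[of n] have "card (C n) \<le> 4 ^ Suc n"
        by linarith
      then show "real (card (C n)) \<le> 4 ^ Suc n"
        by (metis of_nat_le_iff of_nat_numeral of_nat_power)
    qed simp
    also have "(4::real) ^ Suc n * (1/8) ^ n = 4 * (1/2) ^ n"
      by (simp flip: power_mult_distrib)
    finally show ?thesis .
  qed
  have fin_A: "emeasure lborel (A n) < \<infinity>" for n
    using A_le[of n] ennreal_less_top order_le_less_trans by fastforce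
  have "limsup A \<in> null_sets lborel"
  proof (rule borel_cantelli_limsup1[OF A_sets fin_A])
    have "summable (\<lambda>n. 4 * (1/2 :: real) ^ n)"
      by (intro summable_mult summable_geometric) simp
    moreover have "norm (measure lborel (A n)) \<le> 4 * (1/2) ^ n" for n
      using A_le[of n] by (simp add: measure_def enn2real_leI)
    ultimately show "summable (\<lambda>n. measure lborel (A n))"
      by (rule summable_comparison_test')
  qed
  then have "limsup A \<in> null_sets lebesgue"
    by (rule null_sets_completionI)
  moreover have "\<Union>\<N> \<subseteq> limsup A"
  proof
    fix x assume "x \<in> \<Union>\<N>"
    then obtain N where N: "N \<in> \<N>" "x \<in> N"
      by blast
    have "\<exists>\<^sub>F n in sequentially. x \<in> E (f N n) \<and> f N n \<in> \<phi> n"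
      using f(2)[OF N] \<phi>(3)[OF N(1)] by (rule frequently_eventually_frequently)
    then have "\<exists>\<^sub>F n in sequentially. x \<in> A n"
      by (rule frequently_elim1) (use f(1)[OF N(1)] in \<open>auto simp: A_def C_def\<close>)
    then show "x \<in> limsup A"
      by (simp add: mem_limsup_iff)
  qed
  ultimately show ?thesis
    unfolding null_ideal_def by (metis null_sets_completion_subset)
qed


section \<open>Meager sets\<close>

lemma nowhere_dense_Un:
  assumes "nowhere_dense S" "nowhere_dense T"
  shows "nowhere_dense (S \<union> T)"
  using assms interior_closed_Un_empty_interior[of "closure S" "closure T"]
  by (simp add: nowhere_dense_def)

lemma nowhere_dense_UN_atMost:
  assumes "\<And>n. nowhere_dense (S n)"
  shows "nowhere_dense (\<Union>i\<le>n::nat. S i)"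
  by (induction n) (auto simp: assms atMost_Suc intro: nowhere_dense_Un)

text \<open>Pairing repeats every base set at infinitely many indices, so that tails of the
  enumeration are still rich enough for density arguments.\<close>

lemma infinitely_recurring_base:
  obtains b :: "nat \<Rightarrow> 'a::second_countable_topology set" where
    "\<And>i. open (b i)" "\<And>i. b i \<noteq> {}" "\<And>U m. open U \<Longrightarrow> U \<noteq> {} \<Longrightarrow> \<exists>n\<ge>m. b n \<subseteq> U"
proof -
  obtain \<B> :: "'a set set" where \<B>: "countable \<B>" "topological_basis \<B>"
    using ex_countable_basis by blast
  define c where "c = from_nat_into (\<B> - {{}})"
  have ex: "\<exists>B \<in> \<B> - {{}}. B \<subseteq> U" if U: "open U" "U \<noteq> {}" for U
  proof -
    obtain x where "x \<in> U"
      using U(2) by blast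
    then obtain B where "B \<in> \<B>" "x \<in> B" "B \<subseteq> U"
      using topological_basisE[OF \<B>(2) U(1)] by metis
    then show ?thesis
      by blast
  qed
  then have "\<B> - {{}} \<noteq> {}"
    using open_UNIV by blast
  then have range_c: "range c = \<B> - {{}}"
    using \<B>(1) by (simp add: c_def range_from_nat_into)
  define b where "b n = c (fst (prod_decode n))" for n
  have b: "b i \<in> \<B> - {{}}" for i
    unfolding b_def using range_c by blast
  show ?thesis
  proof (rule that[of b])
    show "open (b i)" for i
      using b[of i] topological_basis_open[OF \<B>(2)] by blast
    show "b i \<noteq> {}" for i
      using b[of i] by blast
    fix U :: "'a set" and m assume "open U" "U \<noteq> {}"
    then obtain i where "c i \<subseteq> U"
      using ex range_c by (metis imageE)
    then have "b (prod_encode (i, m)) \<subseteq> U"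
      by (simp add: b_def)
    then show "\<exists>n\<ge>m. b n \<subseteq> U"
      using le_prod_encode_2 by blast
  qed
qed

text \<open>Choose \<open>b (t j)\<close> inside \<open>b j\<close> and off the closure of the first
  \<open>j + 1\<close> nowhere dense sets. A point of \<open>M\<close> lies in one of the nowhere
  dense sets and is avoided from its index on.\<close>

lemma meager_escape:
  fixes b :: "nat \<Rightarrow> real set"
  assumes b: "\<And>i. open (b i)" "\<And>i. b i \<noteq> {}" "\<And>U m. open U \<Longrightarrow> U \<noteq> {} \<Longrightarrow> \<exists>n\<ge>m. b n \<subseteq> U"
    and M: "M \<in> meager_ideal"
  shows "\<exists>t. (\<forall>j. j \<le> t j \<and> b (t j) \<subseteq> b j) \<and> (\<forall>x\<in>M. \<forall>\<^sub>F j in sequentially. x \<notin> b (t j))"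
proof -
  obtain S :: "nat \<Rightarrow> real set" where S: "\<And>n. nowhere_dense (S n)" "M \<subseteq> (\<Union>n. S n)"
    using M by (auto simp: meager_ideal_def)
  define C where "C n = closure (\<Union>i\<le>n. S i)" for n
  have "\<exists>l\<ge>j. b l \<subseteq> b j - C j" for j
  proof (rule b(3))
    show "open (b j - C j)"
      using b(1) by (simp add: C_def open_Diff)
    have "interior (C j) = {}"
      using nowhere_dense_UN_atMost[of S j] S(1) by (simp add: C_def nowhere_dense_def)
    then show "b j - C j \<noteq> {}"
      using b(1)[of j] b(2)[of j] interior_maximal[of "b j" "C j"] by auto
  qed
  then obtain t where t: "\<And>j. j \<le> t j" "\<And>j. b (t j) \<subseteq> b j - C j"
    by metis
  have "\<forall>\<^sub>F j in sequentially. x \<notin> b (t j)" if x: "x \<in> M" for x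
  proof -
    obtain n where n: "x \<in> S n"
      using x S(2) by blast
    have "x \<notin> b (t j)" if "n \<le> j" for j
    proof -
      have "x \<in> (\<Union>i\<le>j. S i)"
        using n that by auto
      then have "x \<in> C j"
        by (simp add: C_def closure_subset[THEN subsetD])
      then show ?thesis
        using t(2) by blast
    qed
    then show ?thesis
      using eventually_sequentially by blast
  qed
  then show ?thesis
    using t by blast
qed

lemma localized_imp_le_star_bounded:
  assumes "localized F"
  shows "\<exists>g. \<forall>f\<in>F. le_star f g"
proof -
  obtain \<phi> where \<phi>: "\<And>n. finite (\<phi> n)" "\<And>f. f \<in> F \<Longrightarrow> \<forall>\<^sub>F n in sequentially. f n \<in> \<phi> n"
    using assms by (auto simp: localized_def)
  have "le_star f (\<lambda>n. Max (\<phi> n))" if "f \<in> F" for f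
    unfolding le_star_def using \<phi>(2)[OF that] by (rule eventually_mono) (simp add: \<phi>(1))
  then show ?thesis
    by blast
qed

text \<open>The localized code at \<open>n\<close> is the table of \<open>t M\<close> up to \<open>(G ^^ 4 ^ Suc n) n\<close>. Starting from
  the base set \<open>b n\<close> and shrinking it once along each of the at most \<open>4 ^ Suc n\<close> candidate
  tables never leaves the range of the tables, and one of these steps escapes from \<open>M\<close>.\<close>

lemma Union_meager_ideal:
  assumes loc: "\<And>F. |F| \<le>o aleph1 \<Longrightarrow> localized F"
    and I: "\<M> \<subseteq> meager_ideal" "|\<M>| \<le>o aleph1"
  shows "\<Union>\<M> \<in> meager_ideal"
proof -
  obtain b :: "nat \<Rightarrow> real set" where b: "\<And>i. open (b i)" "\<And>i. b i \<noteq> {}"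
    "\<And>U m. open U \<Longrightarrow> U \<noteq> {} \<Longrightarrow> \<exists>n\<ge>m. b n \<subseteq> U"
    using infinitely_recurring_base by blast
  have "\<exists>t. (\<forall>j. j \<le> t j \<and> b (t j) \<subseteq> b j) \<and> (\<forall>x\<in>M. \<forall>\<^sub>F j in sequentially. x \<notin> b (t j))"
    if "M \<in> \<M>" for M
    using meager_escape[OF b] that I(1) by blast
  then obtain t where t: "\<And>M j. M \<in> \<M> \<Longrightarrow> j \<le> t M j" "\<And>M j. M \<in> \<M> \<Longrightarrow> b (t M j) \<subseteq> b j"
    "\<And>M x. M \<in> \<M> \<Longrightarrow> x \<in> M \<Longrightarrow> \<forall>\<^sub>F j in sequentially. x \<notin> b (t M j)"
    by metis
  obtain G0 where G0: "\<And>M. M \<in> \<M> \<Longrightarrow> le_star (t M) G0"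
    using localized_imp_le_star_bounded[OF loc[OF image_ordLeq_aleph1[OF I(2), of t]]] by blast
  define G where "G n = n + (\<Sum>i\<le>n. G0 i)" for n
  have G_ge: "n \<le> G n" and G_ge0: "G0 n \<le> G n" for n
    using member_le_sum[of n "{..n}" G0] by (auto simp: G_def)
  have G_mono: "G m \<le> G n" if "m \<le> n" for m n
    using that unfolding G_def by (intro add_mono sum_mono2) auto
  have pow_mono: "(G ^^ i) n \<le> (G ^^ j) n" if "i \<le> j" for i j n
    using that by (induction rule: dec_induct) (auto intro: order_trans[OF _ G_ge])
  define table where "table M n = to_nat (map (t M) [0..<Suc ((G ^^ (4 ^ Suc n)) n)])" for M n
  obtain \<phi> where \<phi>: "\<And>n. finite (\<phi> n)" "\<And>n. card (\<phi> n) \<le> 4 ^ Suc n"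
    "\<And>M. M \<in> \<M> \<Longrightarrow> \<forall>\<^sub>F n in sequentially. table M n \<in> \<phi> n"
    using loc[OF image_ordLeq_aleph1[OF I(2), of table]] unfolding localized_def by blast
  \<comment> \<open>The guards make \<open>step\<close> stay put on a code that offers no admissible
    value, so shrinking and the growth bound \<open>G\<close> hold for arbitrary
    \<open>c\<close>.\<close>
  define step where "step l c = (let T = from_nat c :: nat list in
    if l < length T \<and> l \<le> T ! l \<and> T ! l \<le> G l \<and> b (T ! l) \<subseteq> b l then T ! l else l)" for l c
  have step: "l \<le> step l c" "step l c \<le> G l" "b (step l c) \<subseteq> b l" for l c
    using G_ge by (auto simp: step_def Let_def)
  have b_foldl: "b (foldl step l cs) \<subseteq> b l" for l cs
    by (induction cs arbitrary: l) (simp_all, meson order_trans step(3))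
  have foldl_ge: "l \<le> foldl step l cs" for l cs
    by (induction cs arbitrary: l) (auto intro: order_trans[OF step(1)])
  have foldl_le: "foldl step l cs \<le> (G ^^ length cs) l" for l cs
    by (induction cs rule: rev_induct) (auto intro: order_trans[OF step(2)] G_mono)
  define W where "W n = b (foldl step n (sorted_list_of_set (\<phi> n)))" for n
  have W_sub: "W n \<subseteq> b n" for n
    by (simp add: W_def b_foldl)
  \<comment> \<open>Every nonempty open set contains some \<open>b n\<close> with
    \<open>n \<ge> m\<close>, hence the nonempty open \<open>W n\<close>; so the closed set
    \<open>S m\<close> has empty interior.\<close>
  define S where "S m = - (\<Union>n\<in>{m..}. W n)" for m
  have "nowhere_dense (S m)" for m
  proof -
    have "closed (S m)"
      unfolding S_def W_def using b(1) by (intro closed_Compl open_UN) auto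
    moreover have "interior (S m) = {}"
    proof (rule ccontr)
      assume "interior (S m) \<noteq> {}"
      then obtain n where n: "m \<le> n" "b n \<subseteq> interior (S m)"
        using b(3)[of "interior (S m)" m] by auto
      then have "W n \<subseteq> S m"
        using W_sub interior_subset by blast
      moreover have "W n \<noteq> {}"
        by (simp add: W_def b(2))
      ultimately show False
        using n(1) by (auto simp: S_def)
    qed
    ultimately show ?thesis
      by (simp add: nowhere_dense_def)
  qed
  moreover have "\<Union>\<M> \<subseteq> (\<Union>m. S m)"
  proof
    fix x assume "x \<in> \<Union>\<M>"
    then obtain M where M: "M \<in> \<M>" "x \<in> M"
      by blast
    obtain m1 where m1: "\<And>n. m1 \<le> n \<Longrightarrow> table M n \<in> \<phi> n"
      using \<phi>(3)[OF M(1)] unfolding eventually_sequentially by blast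
    obtain m2 where m2: "\<And>j. m2 \<le> j \<Longrightarrow> t M j \<le> G0 j"
      using G0[OF M(1)] unfolding le_star_def eventually_sequentially by blast
    obtain m3 where m3: "\<And>j. m3 \<le> j \<Longrightarrow> x \<notin> b (t M j)"
      using t(3)[OF M] unfolding eventually_sequentially by blast
    have "x \<notin> W n" if n: "m1 \<le> n" "m2 \<le> n" "m3 \<le> n" for n
    proof -
      have "table M n \<in> set (sorted_list_of_set (\<phi> n))"
        using m1[OF n(1)] \<phi>(1) by simp
      then obtain xs ys where xs: "sorted_list_of_set (\<phi> n) = xs @ table M n # ys"
        by (meson split_list)
      define l where "l = foldl step n xs"
      have "length (sorted_list_of_set (\<phi> n)) \<le> 4 ^ Suc n"
        using \<phi>(2) by simp
      then have "length xs \<le> 4 ^ Suc n"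
        unfolding xs by simp
      then have l: "n \<le> l" "l < Suc ((G ^^ (4 ^ Suc n)) n)"
        using foldl_ge[of n xs] order_trans[OF foldl_le pow_mono, of xs "4 ^ Suc n" n]
        by (auto simp: l_def less_Suc_eq_le)
      have "t M l \<le> G l"
        using m2[of l] G_ge0[of l] n l(1) by linarith
      then have "step l (table M n) = t M l"
        using l(2) t(1,2)[OF M(1), of l] by (simp add: step_def table_def Let_def del: upt_Suc)
      then have "W n = b (foldl step (t M l) ys)"
        by (simp add: W_def xs l_def)
      then show ?thesis
        using b_foldl[of "t M l" ys] m3[of l] n l(1) by auto
    qed
    then have "x \<in> S (max m1 (max m2 m3))"
      by (auto simp: S_def)
    then show "x \<in> (\<Union>m. S m)"
      by blast
  qed
  ultimately show ?thesis
    unfolding meager_ideal_def by blast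
qed


section \<open>The Cichon diagram\<close>

lemma aleph1_less_least_card:
  assumes "F \<noteq> {}" "\<And>X. X \<in> F \<Longrightarrow> \<not> |X| \<le>o aleph1"
  shows "aleph1 <o least_card F"
proof -
  obtain X where X: "X \<in> F" "least_card F = |X|"
    using least_card(1)[OF assms(1)] by blast
  have "\<not> |X| \<le>o aleph1"
    using assms(2) X(1) .
  then show ?thesis
    unfolding X(2) using not_ordLeq_iff_ordLess[of aleph1 "|X|"] card_of_Well_order
      cardSuc_Well_order[OF natLeq_Card_order] by blast
qed

text \<open>Additivity alone suffices. Sets of size at most \<open>aleph1\<close> are unions of that
  many singletons, so they lie in \<open>I\<close>; choosing a point outside each member of a family
  of that size gives such a set that no member covers.\<close>

lemma aleph1_less_ideal_cardinals:
  fixes I :: "'a set set"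
  assumes proper: "UNIV \<notin> I" "\<And>x. {x} \<in> I"
    and add: "\<And>F. F \<subseteq> I \<Longrightarrow> |F| \<le>o aleph1 \<Longrightarrow> \<Union>F \<in> I"
  shows "aleph1 <o add_ideal I" "aleph1 <o cov_ideal I" "aleph1 <o non_ideal I" "aleph1 <o cof_ideal I"
proof -
  have non: "X \<in> I" if "|X| \<le>o aleph1" for X
  proof -
    have "\<Union>((\<lambda>x. {x}) ` X) \<in> I"
      using proper(2) that by (intro add image_ordLeq_aleph1) auto
    then show ?thesis
      by simp
  qed
  have cof: False if F: "F \<subseteq> I" "\<forall>X\<in>I. \<exists>Y\<in>F. X \<subseteq> Y" "|F| \<le>o aleph1" for F
  proof -
    have "\<exists>x. x \<notin> Y" if "Y \<in> F" for Y
      using that F(1) proper(1) by (metis UNIV_eq_I subsetD)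
    then obtain x where x: "\<And>Y. Y \<in> F \<Longrightarrow> x Y \<notin> Y"
      by metis
    have "x ` F \<in> I"
      by (intro non image_ordLeq_aleph1 F)
    then obtain Y where "Y \<in> F" "x ` F \<subseteq> Y"
      using F(2) by blast
    then show False
      using x by blast
  qed
  note ne = ideal_families_nonempty[of I, OF proper]
  show "aleph1 <o add_ideal I"
    unfolding add_ideal_def
  proof (rule aleph1_less_least_card[OF ne(1)])
    show "\<not> |F| \<le>o aleph1" if "F \<in> {F. F \<subseteq> I \<and> \<Union>F \<notin> I}" for F
      using add[of F] that by auto
  qed
  show "aleph1 <o cov_ideal I"
    unfolding cov_ideal_def
  proof (rule aleph1_less_least_card[OF ne(2)])
    show "\<not> |F| \<le>o aleph1" if "F \<in> {F. F \<subseteq> I \<and> \<Union>F = UNIV}" for F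
      using add[of F] proper(1) that by auto
  qed
  show "aleph1 <o non_ideal I"
    unfolding non_ideal_def
  proof (rule aleph1_less_least_card[OF ne(3)])
    show "\<not> |X| \<le>o aleph1" if "X \<in> {X. X \<notin> I}" for X
      using non[of X] that by auto
  qed
  show "aleph1 <o cof_ideal I"
    unfolding cof_ideal_def
  proof (rule aleph1_less_least_card[OF ne(4)])
    show "\<not> |F| \<le>o aleph1" if "F \<in> {F. F \<subseteq> I \<and> (\<forall>X\<in>I. \<exists>Y\<in>F. X \<subseteq> Y)}" for F
      using cof[of F] that by (simp only: mem_Collect_eq) blast
  qed
qed

lemma Cichon_above_aleph1:
  assumes loc: "\<And>F. |F| \<le>o aleph1 \<Longrightarrow> localized F"
  shows "Cichon_above aleph1"
proof -
  have bounded: "\<exists>g. \<forall>f\<in>F. le_star f g" if "|F| \<le>o aleph1" for F :: "(nat \<Rightarrow> nat) set"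
    by (rule localized_imp_le_star_bounded[OF loc[OF that]])
  have "\<not> |F| \<le>o aleph1" if F: "\<forall>g. \<exists>f\<in>F. le_star g f" for F :: "(nat \<Rightarrow> nat) set"
  proof
    assume "|F| \<le>o aleph1"
    then obtain g where g: "\<forall>f\<in>F. le_star f g"
      using bounded by blast
    obtain f where f: "f \<in> F" "le_star (\<lambda>n. Suc (g n)) f"
      using F by blast
    then have "le_star (\<lambda>n. Suc (g n)) g"
      using g le_star_trans by blast
    then show False
      by (simp add: le_star_def)
  qed
  then have "aleph1 <o dominating_number"
    unfolding dominating_number_def
    by (intro aleph1_less_least_card[OF dominating_family_nonempty]) blast
  moreover have "aleph1 <o bounding_number"
    unfolding bounding_number_def
    by (rule aleph1_less_least_card[OF bounding_family_nonempty]) (use bounded in blast)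
  moreover note aleph1_less_ideal_cardinals[OF null_ideal_proper Union_null_ideal[OF loc]]
    aleph1_less_ideal_cardinals[OF meager_ideal_proper Union_meager_ideal[OF loc]]
  ultimately show ?thesis
    unfolding Cichon_above_def by blast
qed

theorem theorem1p5:
  shows "(BA_Lip_Cantor \<longrightarrow> Cichon_above aleph1) \<and> (BA_Lip_Baire \<longrightarrow> Cichon_above aleph1)"
proof (intro conjI impI Cichon_above_aleph1)
  fix F :: "(nat \<Rightarrow> nat) set"
  assume BA: BA_Lip_Cantor and F: "|F| \<le>o aleph1"
  interpret Lip_cover False True
    using BA by unfold_locales (auto simp: BA_Lip_Cantor_def)
  show "localized F"
    using F by (rule localization)
next
  fix F :: "(nat \<Rightarrow> nat) set"
  assume BA: BA_Lip_Baire and F: "|F| \<le>o aleph1"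
  interpret Lip_cover "0 :: nat" 1
  proof
    fix A B :: "(nat \<Rightarrow> nat) set"
    assume "aleph1_dense A" "aleph1_dense B"
    then obtain f :: "(nat \<Rightarrow> nat) \<Rightarrow> nat \<Rightarrow> nat" where "Lip f" "bij_betw f A B"
      using BA unfolding BA_Lip_Baire_def by blast
    then show "\<exists>f :: nat \<Rightarrow> (nat \<Rightarrow> nat) \<Rightarrow> (nat \<Rightarrow> nat). (\<forall>n. Lip (f n)) \<and> B = (\<Union>n. f n ` A)"
      by (intro exI[of _ "\<lambda>_. f"]) (simp add: bij_betw_imp_surj_on)
  qed simp
  show "localized F"
    using F by (rule localization)
qed

end
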